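(* Assume that for every $\theta\in\Theta$, $Q_\theta=(q_{ij}(\theta))_{1\le i,j\le N}$ is a real matrix with $q_{ij}(\theta)\ge0$ for $i\neq j$ and $q_{ii}(\theta)=-\sum_{j\ne i}q_{ij}(\theta)$; that there exists $L_Q>0$ with $\|Q_\theta^*-Q_{\bar\theta}^*\|_{1\to1}\le L_Q|\theta-\bar\theta|$ for all $\theta,\bar\theta\in\Theta$; and that there exist constants $C_{\mathrm{mix}}\ge1$ and $\gamma>0$ such that $$|e^{tQ_\theta^*}\xi|_1\le C_{\mathrm{mix}}e^{-\gamma t}|\xi|_1\qquad\text{for all }\theta\in\Theta,\ \xi\in\mathcal{Z},\ t\ge0 .$$ Then for each $\theta\in\Theta$ there exists a unique vector $\mu_\theta\in\Delta_S$ such that $Q_\theta^*\mu_\theta=0$. Moreover, the map $\Theta\ni\theta\mapsto\mu_\theta\in\Delta_S$ is Lipschitz and satisfies $$|\mu_\theta-\mu_{\bar\theta}|_1\le\frac{C_{\mathrm{mix}}L_Q}{\gamma}\,|\theta-\bar\theta|\qquad\text{for all }\theta,\bar\theta\in\Theta .$$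
   Context: $N,d\ge1$ are integers, $R_\theta>0$ is a constant (the subscript is part of its name), and $\Theta=[-R_\theta,R_\theta]^d$. $\Delta_S=\{\mu\in[0,\infty)^N:\sum_{i=1}^N\mu_i=1\}$ and $\mathcal{Z}=\{\xi\in\mathbb{R}^N:\sum_{i=1}^N\xi_i=0\}$. $Q_\theta^*$ is the transpose of $Q_\theta$, acting on column vectors. $|\cdot|_1$ is the $\ell^1$-norm on $\mathbb{R}^N$, $\|\cdot\|_{1\to1}$ the induced operator norm, and $|\cdot|$ the Euclidean norm on $\mathbb{R}^d$. *)

theory Defs
  imports "HOL-Analysis.Analysis"
begin

definition l1_norm :: "real ^ 'n \<Rightarrow> real" where
  "l1_norm x = (\<Sum>i\<in>UNIV. \<bar>x $ i\<bar>)"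

text \<open>Same form as \<open>onorm\<close>; the value at \<open>x = 0\<close> is \<open>0 / 0 = 0\<close>, and the set of
  quotients is bounded because the dimension is finite.\<close>

definition l1_opnorm :: "real ^ 'n ^ 'n \<Rightarrow> real" where
  "l1_opnorm A = (SUP x. l1_norm (A *v x) / l1_norm x)"

text \<open>The type class operations \<open>*\<close> and \<open>^\<close> on vectors are componentwise, so the class function
  \<open>exp\<close> is of no use here; the exponential is the power series for the matrix product \<open>**\<close>.
  It converges for every matrix, so \<open>suminf\<close> is its limit.\<close>

primrec mat_pow :: "real ^ 'n ^ 'n \<Rightarrow> nat \<Rightarrow> real ^ 'n ^ 'n" where
  "mat_pow A 0 = mat 1"
| "mat_pow A (Suc k) = A ** mat_pow A k"

definition mat_exp :: "real ^ 'n ^ 'n \<Rightarrow> real ^ 'n ^ 'n" where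
  "mat_exp A = (\<Sum>k. (1 / fact k) *\<^sub>R mat_pow A k)"

definition param_cube :: "real \<Rightarrow> (real ^ 'd) set" where
  "param_cube R = {\<theta>. \<forall>k. - R \<le> \<theta> $ k \<and> \<theta> $ k \<le> R}"

definition prob_simplex :: "(real ^ 'n) set" where
  "prob_simplex = {\<mu>. (\<forall>i. 0 \<le> \<mu> $ i) \<and> (\<Sum>i\<in>UNIV. \<mu> $ i) = 1}"

definition zero_sum :: "(real ^ 'n) set" where
  "zero_sum = {\<xi>. (\<Sum>i\<in>UNIV. \<xi> $ i) = 0}"

definition rate_matrix :: "real ^ 'n ^ 'n \<Rightarrow> bool" where
  "rate_matrix A \<longleftrightarrow>
    (\<forall>i j. i \<noteq> j \<longrightarrow> 0 \<le> A $ i $ j) \<and>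
    (\<forall>i. A $ i $ i = - (\<Sum>j\<in>UNIV - {i}. A $ i $ j))"

definition stationary_vec :: "real ^ 'n ^ 'n \<Rightarrow> real ^ 'n" where
  "stationary_vec A = (THE \<mu>. \<mu> \<in> prob_simplex \<and> transpose A *v \<mu> = 0)"

end

theory Submission
  imports Defs
begin

text \<open>The spectral gap says that a rate matrix is quantitatively invertible on \<open>zero_sum\<close>: with
  \<open>B = transpose Q\<close>, integrating \<open>d/dt e\<^sup>t\<^sup>B \<xi> = e\<^sup>t\<^sup>B B \<xi>\<close> from \<open>0\<close> to \<open>\<infinity>\<close> gives
  \<open>\<bar>\<xi>\<bar>\<^sub>1 \<le> C/\<gamma> \<bar>B \<xi>\<bar>\<^sub>1\<close>. Uniqueness follows with \<open>\<xi>\<close> the difference of two stationary vectors of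
  the same matrix, and the Lipschitz bound with \<open>\<xi> = \<mu> - \<mu>'\<close> for two parameters, because then
  \<open>B \<xi> = - (B - B') \<mu>'\<close>. Existence is Brouwer's theorem for \<open>I + B/c\<close>, which maps the simplex
  to itself for large \<open>c\<close>.\<close>

section \<open>The l1 norm and its operator norm\<close>

lemma l1_norm_nonneg: "0 \<le> l1_norm x"
  by (simp add: l1_norm_def sum_nonneg)

lemma l1_norm_minus: "l1_norm (- x) = l1_norm x"
  by (simp add: l1_norm_def)

lemma l1_norm_eq_0_iff: "l1_norm x = 0 \<longleftrightarrow> x = 0"
  by (simp add: l1_norm_def sum_nonneg_eq_0_iff vec_eq_iff)

lemma norm_le_l1_norm: "norm x \<le> l1_norm x"
  unfolding l1_norm_def by (rule norm_le_l1_cart)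

lemma l1_norm_prob_simplex: "\<mu> \<in> prob_simplex \<Longrightarrow> l1_norm \<mu> = 1"
  by (simp add: prob_simplex_def l1_norm_def)

text \<open>A supremum of reals bounds its members only once the set is known to be bounded above.
  The entrywise sum \<open>M\<close> is a crude bound on all quotients and serves only for
  that.\<close>

lemma l1_norm_matrix_vector_le:
  "l1_norm (A *v x) \<le> l1_opnorm A * l1_norm x"
proof (cases "x = 0")
  case True
  then show ?thesis by (simp add: l1_norm_def)
next
  case False
  define M where "M = (\<Sum>i\<in>UNIV. \<Sum>j\<in>UNIV. \<bar>A $ i $ j\<bar>)"
  have *: "l1_norm (A *v y) \<le> M * l1_norm y" for y
  proof -
    have "l1_norm (A *v y) \<le> (\<Sum>i\<in>UNIV. \<Sum>j\<in>UNIV. \<bar>A $ i $ j\<bar> * \<bar>y $ j\<bar>)"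
      unfolding l1_norm_def matrix_vector_mult_def
      by (auto intro!: sum_mono order_trans[OF sum_abs] simp: abs_mult)
    also have "\<dots> \<le> (\<Sum>i\<in>UNIV. \<Sum>j\<in>UNIV. \<bar>A $ i $ j\<bar> * l1_norm y)"
      unfolding l1_norm_def by (intro sum_mono mult_left_mono member_le_sum) auto
    finally show ?thesis
      by (simp add: M_def sum_distrib_right)
  qed
  have pos: "0 < l1_norm x"
    using False l1_norm_nonneg[of x] l1_norm_eq_0_iff[of x] by linarith
  have "l1_norm (A *v y) / l1_norm y \<le> M" for y
  proof (cases "y = 0")
    case True
    then show ?thesis by (simp add: l1_norm_def M_def sum_nonneg)
  next
    case False
    then have "0 < l1_norm y"
      using l1_norm_nonneg[of y] l1_norm_eq_0_iff[of y] by linarith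
    then show ?thesis using *[of y] by (simp add: divide_le_eq)
  qed
  then have "bdd_above (range (\<lambda>y. l1_norm (A *v y) / l1_norm y))"
    by (auto intro!: bdd_aboveI)
  then have "l1_norm (A *v x) / l1_norm x \<le> l1_opnorm A"
    unfolding l1_opnorm_def by (rule cSUP_upper[rotated]) simp
  then show ?thesis using pos by (simp add: divide_le_eq)
qed

section \<open>Convergence and derivative of the matrix exponential\<close>

lemma mat_pow_scaleR: "mat_pow (t *\<^sub>R A) k = t ^ k *\<^sub>R mat_pow A k"
  by (induction k) (simp_all add: matrix_scalar_ac scalar_matrix_assoc[symmetric] mult.commute)

text \<open>\<open>mat_pow\<close> adds factors on the left. With the new factor on the right,
  differentiating the series lets \<open>A\<close> act on the vector first.\<close>

lemma mat_pow_Suc_right: "mat_pow A (Suc k) = mat_pow A k ** A"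
proof (induction k)
  case (Suc k)
  have "mat_pow A (Suc (Suc k)) = A ** (mat_pow A k ** A)"
    using Suc by simp
  then show ?case by (simp add: matrix_mul_assoc)
qed simp

text \<open>Left multiplication by \<open>A\<close> is linear in finite dimension, hence bounded by
  some \<open>K\<close>; iterating it from the identity gives geometric growth. The norm here is the
  Euclidean norm of the entries, so \<open>norm (mat 1)\<close> need not be 1.\<close>

lemma mat_pow_bound: "\<exists>K. \<forall>k. norm (mat_pow A k) \<le> norm (mat 1 :: real ^ 'n ^ 'n) * K ^ k"
  for A :: "real ^ 'n ^ 'n"
proof -
  have "linear (\<lambda>B. A ** B :: real ^ 'n ^ 'n)"
    by (rule linearI) (simp_all add: matrix_add_ldistrib matrix_scalar_ac scalar_matrix_assoc[symmetric])
  then have "bounded_linear (\<lambda>B. A ** B :: real ^ 'n ^ 'n)"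
    by (simp add: linear_conv_bounded_linear)
  then obtain K where K: "0 \<le> K" "\<And>B. norm (A ** B :: real ^ 'n ^ 'n) \<le> norm B * K"
    using bounded_linear.nonneg_bounded by blast
  have "norm (mat_pow A k) \<le> norm (mat 1 :: real ^ 'n ^ 'n) * K ^ k" for k
  proof (induction k)
    case (Suc k)
    have "norm (mat_pow A (Suc k)) \<le> norm (mat_pow A k) * K"
      using K(2) by simp
    also have "\<dots> \<le> norm (mat 1 :: real ^ 'n ^ 'n) * K ^ k * K"
      by (rule mult_right_mono[OF Suc K(1)])
    finally show ?case by (simp add: mult_ac)
  qed simp
  then show ?thesis by blast
qed

lemma summable_mat_exp: "summable (\<lambda>k. (1 / fact k) *\<^sub>R mat_pow A k)"
proof -
  obtain K where K: "\<And>k. norm (mat_pow A k) \<le> norm (mat 1 :: real ^ 'a ^ 'a) * K ^ k"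
    using mat_pow_bound[of A] by blast
  have "summable (\<lambda>k. norm (mat 1 :: real ^ 'a ^ 'a) * (inverse (fact k) * K ^ k))"
    by (rule summable_mult[OF summable_exp])
  moreover have "norm ((1 / fact k) *\<^sub>R mat_pow A k)
      \<le> norm (mat 1 :: real ^ 'a ^ 'a) * (inverse (fact k) * K ^ k)" for k
    using K[of k] by (simp add: field_simps)
  ultimately show ?thesis
    by (rule summable_comparison_test'[where N = 0])
qed

text \<open>Fixing \<open>s\<close> and \<open>v\<close> turns the matrix series into a real power
  series in \<open>t\<close>, which can be differentiated termwise.\<close>

lemma inner_mat_exp_sums:
  "(\<lambda>k. (s \<bullet> (mat_pow A k *v v) / fact k) * t ^ k) sums (s \<bullet> (mat_exp (t *\<^sub>R A) *v v))"
proof -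
  have "linear (\<lambda>M. s \<bullet> (M *v v))"
    by (rule linearI)
      (simp_all add: matrix_vector_mult_add_rdistrib inner_add_right
        scaleR_matrix_vector_assoc[symmetric])
  then have "bounded_linear (\<lambda>M. s \<bullet> (M *v v))"
    by (simp add: linear_conv_bounded_linear)
  from bounded_linear.sums[OF this summable_sums[OF summable_mat_exp[of "t *\<^sub>R A"]]]
  show ?thesis
    by (simp add: mat_exp_def mat_pow_scaleR scaleR_matrix_vector_assoc[symmetric] mult.commute)
qed

text \<open>The derivative has \<open>A\<close> applied to \<open>v\<close> inside the exponential,
  so that a decay bound for the flow started at \<open>A *v v\<close> controls it.\<close>

lemma inner_mat_exp_deriv:
  "((\<lambda>t. s \<bullet> (mat_exp (t *\<^sub>R A) *v v)) has_real_derivative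
     s \<bullet> (mat_exp (t *\<^sub>R A) *v (A *v v))) (at t)"
proof -
  let ?c = "\<lambda>k. s \<bullet> (mat_pow A k *v v) / fact k"
  have eq: "(\<lambda>t. s \<bullet> (mat_exp (t *\<^sub>R A) *v v)) = (\<lambda>t. \<Sum>k. ?c k * t ^ k)"
    using inner_mat_exp_sums[THEN sums_unique] by (rule ext)
  \<comment> \<open>\<open>diffs\<close> has k-th coefficient \<open>(k + 1) * ?c (k + 1)\<close>:
    the factor k + 1 reduces the factorial to k!, and the spare factor \<open>A\<close> moves onto
    \<open>v\<close>.\<close>
  have "diffs ?c = (\<lambda>k. s \<bullet> (mat_pow A k *v (A *v v)) / fact k)"
    by (rule ext, simp only: diffs_def mat_pow_Suc_right matrix_vector_mul_assoc fact_Suc)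
      (simp add: field_simps del: of_nat_Suc)
  then have "(\<Sum>k. diffs ?c k * t ^ k) = s \<bullet> (mat_exp (t *\<^sub>R A) *v (A *v v))"
    using inner_mat_exp_sums[of s A "A *v v" t] by (simp add: sums_iff)
  moreover have "((\<lambda>t. \<Sum>k. ?c k * t ^ k) has_real_derivative (\<Sum>k. diffs ?c k * t ^ k)) (at t)"
    by (rule termdiffs_strong_converges_everywhere)
      (use inner_mat_exp_sums in \<open>auto simp: sums_iff\<close>)
  ultimately show ?thesis by (simp add: eq)
qed

section \<open>From exponential decay to a bound on the inverse\<close>

lemma inner_le_l1_norm:
  assumes "\<And>i. \<bar>s $ i\<bar> \<le> 1"
  shows "\<bar>s \<bullet> x\<bar> \<le> l1_norm x"
proof -
  have "\<bar>s $ i * x $ i\<bar> \<le> \<bar>x $ i\<bar>" for i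
    using mult_right_mono[OF assms[of i], of "\<bar>x $ i\<bar>"] by (simp add: abs_mult)
  then show ?thesis
    unfolding l1_norm_def inner_vec_def inner_real_def
    by (intro order_trans[OF sum_abs] sum_mono) auto
qed

text \<open>Pairing with the sign vector of \<open>\<xi>\<close>, which norms \<open>\<xi>\<close> in the \<open>\<ell>\<^sup>1\<close> sense, reduces the
  integral of the flow to monotonicity of a real function.\<close>

lemma l1_norm_le_of_exp_decay:
  fixes A :: "real ^ 'n ^ 'n" and \<xi> :: "real ^ 'n"
  assumes "0 < g"
    and dec: "\<And>t. 0 \<le> t \<Longrightarrow> l1_norm (mat_exp (t *\<^sub>R A) *v \<xi>) \<le> C * exp (- g * t) * l1_norm \<xi>"
    and dec': "\<And>t. 0 \<le> t \<Longrightarrow>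
      l1_norm (mat_exp (t *\<^sub>R A) *v (A *v \<xi>)) \<le> C * exp (- g * t) * l1_norm (A *v \<xi>)"
  shows "l1_norm \<xi> \<le> C / g * l1_norm (A *v \<xi>)"
proof -
  define s :: "real ^ 'n" where "s = (\<chi> i. sgn (\<xi> $ i))"
  define u where "u t = s \<bullet> (mat_exp (t *\<^sub>R A) *v \<xi>)" for t
  define b where "b = l1_norm (A *v \<xi>)"
  \<comment> \<open>The subtracted term is the integral of \<open>C * b * exp (- g * r)\<close> over
    r from t to infinity. Its derivative compensates the worst decrease of \<open>u\<close> allowed
    by \<open>dec'\<close>, so \<open>h\<close> is nondecreasing, and \<open>h 0\<close> is the
    difference to be shown nonpositive.\<close>
  define h where "h t = u t - C / g * b * exp (- g * t)" for t
  have s: "\<bar>s $ i\<bar> \<le> 1" for i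
    by (simp add: s_def sgn_if)
  \<comment> \<open>At time 0 the power series collapses to its constant term, since 0 ^ 0 = 1 and
    all other powers of 0 vanish.\<close>
  have "(\<lambda>k. if k = 0 then s \<bullet> \<xi> else 0) sums u 0"
    using inner_mat_exp_sums[of s A \<xi> 0] unfolding u_def
    by (rule sums_cong[THEN iffD1, rotated]) (auto simp: power_0_left)
  moreover have "(\<lambda>k::nat. if k = 0 then s \<bullet> \<xi> else 0) sums (s \<bullet> \<xi>)"
    using sums_single[of 0 "\<lambda>_. s \<bullet> \<xi>"] by simp
  ultimately have "u 0 = s \<bullet> \<xi>"
    by (rule sums_unique2)
  also have "\<dots> = l1_norm \<xi>"
    by (simp add: s_def l1_norm_def inner_vec_def sgn_mult_self_eq abs_sgn mult.commute)
  finally have u0: "u 0 = l1_norm \<xi>" .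
  have h_le: "h 0 \<le> h t" if "0 \<le> t" for t
  proof (rule DERIV_nonneg_imp_nondecreasing[OF that])
    fix x :: real assume x: "0 \<le> x" "x \<le> t"
    let ?d = "s \<bullet> (mat_exp (x *\<^sub>R A) *v (A *v \<xi>))"
    have "(h has_real_derivative ?d + C * b * exp (- g * x)) (at x)"
      unfolding h_def u_def
      by (rule derivative_eq_intros inner_mat_exp_deriv refl)+ (use \<open>0 < g\<close> in simp)
    moreover have "0 \<le> ?d + C * b * exp (- g * x)"
      using inner_le_l1_norm[OF s, of "mat_exp (x *\<^sub>R A) *v (A *v \<xi>)"] dec'[OF x(1)]
      by (simp add: b_def abs_le_iff mult_ac)
    ultimately show "\<exists>y. (h has_real_derivative y) (at x) \<and> 0 \<le> y" by blast
  qed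
  \<comment> \<open>The left side is \<open>h 0\<close>; the right side bounds \<open>h t\<close> by
    the decay of \<xi> itself and tends to 0 as t grows.\<close>
  have "l1_norm \<xi> - C / g * b \<le> (C * l1_norm \<xi> - C / g * b) * exp (- g * t)" if "0 \<le> t" for t
    using h_le[OF that] inner_le_l1_norm[OF s, of "mat_exp (t *\<^sub>R A) *v \<xi>"] dec[OF that]
    by (simp add: h_def u0 algebra_simps) (simp add: u_def)
  then have ev: "\<forall>\<^sub>F t in at_top.
      l1_norm \<xi> - C / g * b \<le> (C * l1_norm \<xi> - C / g * b) * exp (- g * t)"
    by (rule eventually_at_top_linorderI)
  have "((\<lambda>t. (C * l1_norm \<xi> - C / g * b) * exp (- g * t)) \<longlongrightarrow>
      (C * l1_norm \<xi> - C / g * b) * 0) at_top"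
  proof (intro tendsto_mult tendsto_const filterlim_compose[OF exp_at_bot])
    show "filterlim (\<lambda>t. - g * t) at_bot at_top"
      using \<open>0 < g\<close>
      by (intro filterlim_tendsto_neg_mult_at_bot[OF tendsto_const]) (auto simp: filterlim_ident)
  qed
  from tendsto_lowerbound[OF this ev] show ?thesis
    by (simp add: b_def)
qed

section \<open>The simplex and existence of stationary vectors\<close>

lemma compact_prob_simplex: "compact (prob_simplex :: (real ^ 'n) set)"
proof -
  have "bounded (prob_simplex :: (real ^ 'n) set)"
    by (rule boundedI[where B = 1]) (metis norm_le_l1_norm l1_norm_prob_simplex)
  moreover have "closed (prob_simplex :: (real ^ 'n) set)"
    unfolding prob_simplex_def
    by (intro closed_Collect_conj closed_Collect_all closed_Collect_le closed_Collect_eq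
        continuous_intros)
  ultimately show ?thesis by (simp add: compact_eq_bounded_closed)
qed

lemma convex_prob_simplex: "convex (prob_simplex :: (real ^ 'n) set)"
  by (rule convexI) (simp add: prob_simplex_def sum.distrib sum_distrib_left[symmetric])

lemma prob_simplex_nonempty: "(prob_simplex :: (real ^ 'n) set) \<noteq> {}"
proof -
  have "(\<chi> i. 1 / real CARD('n)) \<in> (prob_simplex :: (real ^ 'n) set)"
    by (simp add: prob_simplex_def)
  then show ?thesis by blast
qed

lemma rate_matrix_row_sum:
  assumes "rate_matrix A"
  shows "(\<Sum>j\<in>UNIV. A $ i $ j) = 0"
  using assms by (simp add: rate_matrix_def sum.remove[of UNIV i])

text \<open>Zero row sums of \<open>A\<close> are zero column sums of its transpose. Hence the flow
  preserves total mass, and the decay hypothesis also applies to the image of any vector under the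
  transpose.\<close>

lemma rate_matrix_transpose_zero_sum:
  assumes "rate_matrix A"
  shows "transpose A *v x \<in> zero_sum"
proof -
  have "(\<Sum>i\<in>UNIV. (transpose A *v x) $ i) = (\<Sum>i\<in>UNIV. \<Sum>j\<in>UNIV. A $ j $ i * x $ j)"
    by (simp add: matrix_vector_mult_def transpose_def)
  also have "\<dots> = (\<Sum>j\<in>UNIV. (\<Sum>i\<in>UNIV. A $ j $ i) * x $ j)"
    by (subst sum.swap) (simp add: sum_distrib_right)
  finally show ?thesis
    by (simp add: zero_sum_def rate_matrix_row_sum[OF assms])
qed

lemma rate_matrix_stationary_exists:
  fixes A :: "real ^ 'n ^ 'n"
  assumes "rate_matrix A"
  shows "\<exists>\<mu>. \<mu> \<in> prob_simplex \<and> transpose A *v \<mu> = 0"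
proof -
  \<comment> \<open>\<open>c\<close> dominates every diagonal entry in absolute value, which keeps
    the diagonal of I + B/c nonnegative for B the transpose of \<open>A\<close>; the summand 1 makes
    \<open>c\<close> positive even when the diagonal vanishes.\<close>
  define c where "c = 1 + (\<Sum>i\<in>UNIV. \<bar>A $ i $ i\<bar>)"
  define f where "f \<mu> = \<mu> + (1 / c) *\<^sub>R (transpose A *v \<mu>)" for \<mu>
  have c: "0 < c"
    by (simp add: c_def add_pos_nonneg sum_nonneg)
  have diag: "- (A $ i $ i) \<le> c" for i
    using member_le_sum[of i UNIV "\<lambda>i. \<bar>A $ i $ i\<bar>"] by (simp add: c_def)
  have "f \<mu> \<in> prob_simplex" if \<mu>: "\<mu> \<in> prob_simplex" for \<mu>
  proof -
    have "0 \<le> f \<mu> $ i" for i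
    proof -
      have "0 \<le> (\<Sum>j\<in>UNIV - {i}. A $ j $ i * \<mu> $ j)"
        using assms \<mu>
        by (intro sum_nonneg mult_nonneg_nonneg) (auto simp: rate_matrix_def prob_simplex_def)
      then have "A $ i $ i * \<mu> $ i \<le> (transpose A *v \<mu>) $ i"
        by (simp add: matrix_vector_mult_def transpose_def sum.remove[of UNIV i])
      moreover have "- (A $ i $ i) * \<mu> $ i \<le> c * \<mu> $ i"
        using diag \<mu> by (intro mult_right_mono) (auto simp: prob_simplex_def)
      \<comment> \<open>Off-diagonal inflow is nonnegative, and the outflow from i is at most
        \<open>c * \<mu> $ i\<close>.\<close>
      ultimately have "0 \<le> c * \<mu> $ i + (transpose A *v \<mu>) $ i" by simp
      then have "0 \<le> (c * \<mu> $ i + (transpose A *v \<mu>) $ i) / c" using c by simp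
      then show ?thesis using c by (simp add: f_def add_divide_distrib)
    qed
    moreover have "(\<Sum>i\<in>UNIV. f \<mu> $ i) = 1"
      using \<mu> rate_matrix_transpose_zero_sum[OF assms, of \<mu>]
      by (simp add: f_def prob_simplex_def zero_sum_def sum.distrib sum_divide_distrib[symmetric])
    ultimately show ?thesis by (simp add: prob_simplex_def)
  qed
  moreover have "continuous_on prob_simplex f"
    unfolding f_def by (intro continuous_intros matrix_vector_mult_linear_continuous_on)
  ultimately obtain \<mu> where "\<mu> \<in> prob_simplex" "f \<mu> = \<mu>"
    using brouwer[OF compact_prob_simplex convex_prob_simplex prob_simplex_nonempty, of f] by blast
  then show ?thesis using c by (auto simp: f_def)
qed

lemma diff_prob_simplex_zero_sum:
  "\<mu> \<in> prob_simplex \<Longrightarrow> \<nu> \<in> prob_simplex \<Longrightarrow> \<mu> - \<nu> \<in> zero_sum"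
  by (simp add: prob_simplex_def zero_sum_def sum_subtractf)

theorem proposition5:
  fixes Q :: "real ^ 'd \<Rightarrow> real ^ 'n ^ 'n"
    and R\<^sub>\<theta> L\<^sub>Q C\<^sub>m\<^sub>i\<^sub>x \<gamma> :: real
    and \<Theta> :: "(real ^ 'd) set"
  assumes "R\<^sub>\<theta> > 0"
    and "\<Theta> = param_cube R\<^sub>\<theta>"
    and "\<And>\<theta>. \<theta> \<in> \<Theta> \<Longrightarrow> rate_matrix (Q \<theta>)"
    and "L\<^sub>Q > 0"
    and "\<And>\<theta> \<theta>'. \<theta> \<in> \<Theta> \<Longrightarrow> \<theta>' \<in> \<Theta> \<Longrightarrow>
           l1_opnorm (transpose (Q \<theta>) - transpose (Q \<theta>')) \<le> L\<^sub>Q * norm (\<theta> - \<theta>')"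
    and "C\<^sub>m\<^sub>i\<^sub>x \<ge> 1"
    and "\<gamma> > 0"
    and "\<And>\<theta> \<xi> t. \<theta> \<in> \<Theta> \<Longrightarrow> \<xi> \<in> zero_sum \<Longrightarrow> t \<ge> 0 \<Longrightarrow>
           l1_norm (mat_exp (t *\<^sub>R transpose (Q \<theta>)) *v \<xi>)
             \<le> C\<^sub>m\<^sub>i\<^sub>x * exp (- \<gamma> * t) * l1_norm \<xi>"
  shows "(\<forall>\<theta>\<in>\<Theta>. \<exists>!\<mu>. \<mu> \<in> prob_simplex \<and> transpose (Q \<theta>) *v \<mu> = 0) \<and>
         (\<exists>K. K-lipschitz_on \<Theta> (\<lambda>\<theta>. stationary_vec (Q \<theta>))) \<and>
         (\<forall>\<theta>\<in>\<Theta>. \<forall>\<theta>'\<in>\<Theta>.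
            l1_norm (stationary_vec (Q \<theta>) - stationary_vec (Q \<theta>'))
              \<le> C\<^sub>m\<^sub>i\<^sub>x * L\<^sub>Q / \<gamma> * norm (\<theta> - \<theta>'))"
proof -
  have gap: "l1_norm \<xi> \<le> C\<^sub>m\<^sub>i\<^sub>x / \<gamma> * l1_norm (transpose (Q \<theta>) *v \<xi>)"
    if "\<theta> \<in> \<Theta>" "\<xi> \<in> zero_sum" for \<theta> \<xi>
    by (rule l1_norm_le_of_exp_decay[OF \<open>\<gamma> > 0\<close> assms(8)[OF that] assms(8)[OF that(1)
          rate_matrix_transpose_zero_sum[OF assms(3)[OF that(1)]]]])
  have ex1: "\<exists>!\<mu>. \<mu> \<in> prob_simplex \<and> transpose (Q \<theta>) *v \<mu> = 0" if "\<theta> \<in> \<Theta>" for \<theta>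
  proof (rule ex_ex1I[OF rate_matrix_stationary_exists[OF assms(3)[OF that]]])
    fix \<mu> \<nu>
    assume "\<mu> \<in> prob_simplex \<and> transpose (Q \<theta>) *v \<mu> = 0"
      and "\<nu> \<in> prob_simplex \<and> transpose (Q \<theta>) *v \<nu> = 0"
    then have "l1_norm (\<mu> - \<nu>) \<le> C\<^sub>m\<^sub>i\<^sub>x / \<gamma> * l1_norm (0 :: real ^ 'n)"
      using gap[OF that diff_prob_simplex_zero_sum[of \<mu> \<nu>]]
      by (simp add: matrix_vector_mult_diff_distrib)
    then have "l1_norm (\<mu> - \<nu>) = 0"
      using l1_norm_nonneg[of "\<mu> - \<nu>"] by (simp add: l1_norm_eq_0_iff[THEN iffD2])
    then show "\<mu> = \<nu>" by (simp add: l1_norm_eq_0_iff)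
  qed
  have stat: "stationary_vec (Q \<theta>) \<in> prob_simplex" "transpose (Q \<theta>) *v stationary_vec (Q \<theta>) = 0"
    if "\<theta> \<in> \<Theta>" for \<theta>
    using theI'[OF ex1[OF that]] by (simp_all add: stationary_vec_def)
  have lip: "l1_norm (stationary_vec (Q \<theta>) - stationary_vec (Q \<theta>'))
      \<le> C\<^sub>m\<^sub>i\<^sub>x * L\<^sub>Q / \<gamma> * norm (\<theta> - \<theta>')" if \<theta>: "\<theta> \<in> \<Theta>" "\<theta>' \<in> \<Theta>" for \<theta> \<theta>'
  proof -
    let ?\<mu> = "stationary_vec (Q \<theta>)" and ?\<nu> = "stationary_vec (Q \<theta>')"
    let ?D = "transpose (Q \<theta>) - transpose (Q \<theta>')"
    have "transpose (Q \<theta>) *v (?\<mu> - ?\<nu>) = - (?D *v ?\<nu>)"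
      using stat(2)[OF \<theta>(1)] stat(2)[OF \<theta>(2)]
      by (simp add: matrix_vector_mult_diff_distrib matrix_vector_mult_diff_rdistrib)
    then have "l1_norm (?\<mu> - ?\<nu>) \<le> C\<^sub>m\<^sub>i\<^sub>x / \<gamma> * l1_norm (?D *v ?\<nu>)"
      using gap[OF \<theta>(1) diff_prob_simplex_zero_sum[OF stat(1)[OF \<theta>(1)] stat(1)[OF \<theta>(2)]]]
      by (simp add: l1_norm_minus)
    \<comment> \<open>As a probability vector, \<open>?\<nu>\<close> has l1 norm 1, so the operator
      norm alone bounds the product.\<close>
    moreover have "l1_norm (?D *v ?\<nu>) \<le> L\<^sub>Q * norm (\<theta> - \<theta>')"
      using l1_norm_matrix_vector_le[of ?D ?\<nu>] assms(5)[OF \<theta>]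
      by (simp add: l1_norm_prob_simplex[OF stat(1)[OF \<theta>(2)]])
    then have "C\<^sub>m\<^sub>i\<^sub>x / \<gamma> * l1_norm (?D *v ?\<nu>) \<le> C\<^sub>m\<^sub>i\<^sub>x / \<gamma> * (L\<^sub>Q * norm (\<theta> - \<theta>'))"
      by (rule mult_left_mono) (use \<open>C\<^sub>m\<^sub>i\<^sub>x \<ge> 1\<close> \<open>\<gamma> > 0\<close> in simp)
    ultimately show ?thesis by (simp add: mult.assoc)
  qed
  \<comment> \<open>\<open>lipschitz_on\<close> measures distances in the Euclidean norm on both
    sides; it lies below the l1 norm on the target, so the same constant works.\<close>
  have "(C\<^sub>m\<^sub>i\<^sub>x * L\<^sub>Q / \<gamma>)-lipschitz_on \<Theta> (\<lambda>\<theta>. stationary_vec (Q \<theta>))"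
  proof (rule lipschitz_onI)
    show "dist (stationary_vec (Q \<theta>)) (stationary_vec (Q \<theta>')) \<le> C\<^sub>m\<^sub>i\<^sub>x * L\<^sub>Q / \<gamma> * dist \<theta> \<theta>'"
      if "\<theta> \<in> \<Theta>" "\<theta>' \<in> \<Theta>" for \<theta> \<theta>'
      unfolding dist_norm using norm_le_l1_norm lip[OF that] by (rule order_trans)
    show "0 \<le> C\<^sub>m\<^sub>i\<^sub>x * L\<^sub>Q / \<gamma>"
      using assms(4,6,7) by simp
  qed
  with ex1 lip show ?thesis by blast
qed

end
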